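(* Let $q$ be a prime power with $q\equiv 3 \pmod 8$. Then there exists a symmetric Hadamard matrix of order $q(1+q)$.
   Context: A Hadamard matrix of order $m$ is an $m\times m$ matrix $H$ with entries in $\{+1,-1\}$ such that $HH^T=mI_m$, where $I_m$ is the identity matrix. It is symmetric if $H^T=H$. *)

theory Defs
  imports "Jordan_Normal_Form.Matrix" "HOL-Number_Theory.Prime_Powers"
begin

definition hadamard_mat :: "nat \<Rightarrow> int mat \<Rightarrow> bool" where
  "hadamard_mat m H \<longleftrightarrow>
     H \<in> carrier_mat m m \<and>
     (\<forall>i<m. \<forall>j<m. H $$ (i, j) \<in> {1, -1}) \<and>
     H * transpose_mat H = int m \<cdot>\<^sub>m 1\<^sub>m m"

end

theory Submission
  imports Defs "Jordan_Normal_Form.Char_Poly"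
begin

text \<open>
  Let \<open>\<chi>\<close> be the quadratic character of \<open>\<bbbF>\<^sub>q\<close>, let \<open>X = (\<chi>(i + j))\<close> and let \<open>N\<close> be the permutation
  matrix of \<open>i \<mapsto> - i\<close>. Bordering gives the symmetric matrices \<open>M = [[0, 1], [1, X]]\<close> and
  \<open>P = diag(-1, N)\<close> of order \<open>q + 1\<close>, with disjoint supports, \<open>M M\<^sup>T = q I\<close>, and
  \<open>P M\<^sup>T + M P\<^sup>T = 0\<close> because \<open>\<chi>(-1) = -1\<close>. With \<open>B = X + N\<close>, which satisfies \<open>B J = J\<close> and
  \<open>B B\<^sup>T = (q + 1) I - J\<close>, the symmetric matrix \<open>P \<otimes> J + M \<otimes> B\<close> is Hadamard of order \<open>q (q + 1)\<close>.

  The field \<open>\<bbbF>\<^sub>q\<close> is obtained as \<open>\<int>[\<zeta>]\<close> modulo a maximal ideal containing \<open>p\<close>, where \<open>\<zeta>\<close> is a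
  primitive \<open>n\<close>-th root of unity with \<open>n = q - 1\<close>. A geometric sum shows that the \<open>\<zeta>\<^sup>i\<close> with
  \<open>i < n\<close> stay distinct, Frobenius gives \<open>f\<^sup>q = f\<close> for every residue \<open>f\<close>, and \<open>\<Prod>\<^sub>i (f - \<zeta>\<^sup>i) = f\<^sup>n - 1\<close>
  then forces every nonzero residue to be a power of \<open>\<zeta>\<close>; the character is \<open>\<chi>(\<zeta>\<^sup>i) = (-1)\<^sup>i\<close>.
\<close>

section \<open>The matrix construction\<close>

text \<open>An index \<open>l\<close> of the Kronecker product splits into the block
  \<open>l div q\<close> and the position \<open>l mod q\<close> inside that block.\<close>

lemma sum_div_mod:
  fixes f :: "nat \<Rightarrow> nat \<Rightarrow> 'a::comm_monoid_add"
  assumes "q > 0"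
  shows "(\<Sum>l<r * q. f (l div q) (l mod q)) = (\<Sum>v<r. \<Sum>y<q. f v y)"
proof -
  have "(\<Sum>l = v * q..<v * q + q. f (l div q) (l mod q)) = (\<Sum>y<q. f v y)" for v
    using sum.shift_bounds_nat_ivl[of "\<lambda>l. f (l div q) (l mod q)" 0 "v * q" q] assms
    by (simp add: add.commute lessThan_atLeast0)
  then show ?thesis by (simp flip: sum.nat_group)
qed

text \<open>Expanding the Gram matrix of \<open>P \<otimes> J + M \<otimes> B\<close> gives
  \<open>P P^T \<otimes> q J\<close>, \<open>(P M^T + M P^T) \<otimes> J\<close> and
  \<open>M M^T \<otimes> B B^T\<close>. The second vanishes, and since \<open>P P^T = I\<close> the
  \<open>J\<close> parts of the other two cancel. Here \<open>\<nu>\<close> models negation of field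
  elements, and \<open>skew\<close> encodes \<open>\<chi>(-1) = -1\<close>.\<close>

lemma symmetric_hadamard_from_core:
  fixes X :: "nat \<Rightarrow> nat \<Rightarrow> int" and \<nu> :: "nat \<Rightarrow> nat" and q :: nat
  assumes q: "q > 0"
    and sym: "\<And>i j. i < q \<Longrightarrow> j < q \<Longrightarrow> X i j = X j i"
    and nu: "\<And>i. i < q \<Longrightarrow> \<nu> i < q" "\<And>i. i < q \<Longrightarrow> \<nu> (\<nu> i) = i"
    and zero: "\<And>i. i < q \<Longrightarrow> X i (\<nu> i) = 0"
    and pm: "\<And>i j. i < q \<Longrightarrow> j < q \<Longrightarrow> j \<noteq> \<nu> i \<Longrightarrow> X i j \<in> {1, -1}"
    and row: "\<And>i. i < q \<Longrightarrow> (\<Sum>j<q. X i j) = 0"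
    and orth: "\<And>i i'. i < q \<Longrightarrow> i' < q \<Longrightarrow>
      (\<Sum>j<q. X i j * X i' j) = (if i = i' then int q else 0) - 1"
    and skew: "\<And>i i'. i < q \<Longrightarrow> i' < q \<Longrightarrow> X i' (\<nu> i) = - X i (\<nu> i')"
  shows "\<exists>H. hadamard_mat (q * (1 + q)) H \<and> transpose_mat H = H"
proof -
  define N :: "nat \<Rightarrow> nat \<Rightarrow> int" where "N x y = (if y = \<nu> x then 1 else 0)" for x y
  \<comment> \<open>The border is the last index \<open>q\<close>; the indices below
    \<open>q\<close> stand for the field elements.\<close>
  define P :: "nat \<Rightarrow> nat \<Rightarrow> int" where
    "P u v = (if u = q then (if v = q then -1 else 0) else if v = q then 0 else N u v)" for u v
  define M :: "nat \<Rightarrow> nat \<Rightarrow> int" where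
    "M u v = (if u = q then (if v = q then 0 else 1) else if v = q then 1 else X u v)" for u v
  define B :: "nat \<Rightarrow> nat \<Rightarrow> int" where "B x y = X x y + N x y" for x y
  \<comment> \<open>This is the entry of \<open>P \<otimes> J + M \<otimes> B\<close> in block
    \<open>(u, v)\<close> at position \<open>(x, y)\<close>.\<close>
  define h where "h u x v y = P u v + M u v * B x y" for u x v y
  define m where "m = q * (1 + q)"
  define H where "H = mat m m (\<lambda>(i, j). h (i div q) (i mod q) (j div q) (j mod q))"
  have nu_eq: "y = \<nu> x \<longleftrightarrow> x = \<nu> y" if "x < q" "y < q" for x y
    using nu that by metis
  have N_sym: "N x y = N y x" if "x < q" "y < q" for x y
    using nu_eq[OF that] by (simp add: N_def)
  have sum_N: "(\<Sum>y<q. N x y * f y) = f (\<nu> x)" if "x < q" for x f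
  proof -
    have "(\<Sum>y<q. N x y * f y) = (\<Sum>y<q. if y = \<nu> x then f y else 0)"
      by (intro sum.cong) (auto simp: N_def)
    then show ?thesis using nu(1)[OF that] by simp
  qed
  have sum_N': "(\<Sum>y<q. f y * N x y) = f (\<nu> x)" if "x < q" for x f
    using sum_N[OF that, of f] by (simp add: mult.commute)
  have sum_N1: "(\<Sum>y<q. N x y) = 1" if "x < q" for x
    using sum_N[OF that, of "\<lambda>_. 1"] by simp
  have NN: "N x' (\<nu> x) = (if x = x' then 1 else 0)" if "x < q" "x' < q" for x x'
    using nu that by (auto simp: N_def) (metis nu(2))
  have B_sum: "(\<Sum>y<q. B x y) = 1" if "x < q" for x
    using that by (simp add: B_def sum.distrib row sum_N1)
  have B_orth: "(\<Sum>y<q. B x y * B x' y) = (if x = x' then int q + 1 else 0) - 1"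
    if "x < q" "x' < q" for x x'
  proof -
    \<comment> \<open>The two cross sums are \<open>X x (\<nu> x')\<close> and
      \<open>X x' (\<nu> x)\<close>, which cancel by \<open>skew\<close>.\<close>
    have "(\<Sum>y<q. B x y * B x' y) = (\<Sum>y<q. X x y * X x' y) + (\<Sum>y<q. X x y * N x' y)
        + (\<Sum>y<q. N x y * X x' y) + (\<Sum>y<q. N x y * N x' y)"
      by (simp add: B_def algebra_simps sum.distrib)
    then show ?thesis using that skew[OF that] by (simp add: orth sum_N sum_N' NN)
  qed
  \<comment> \<open>Between two inner rows the border column adds \<open>1\<close>, cancelling the
    \<open>-1\<close> of \<open>orth\<close>; the border row against an inner row gives a row sum of
    \<open>X\<close>, which is \<open>0\<close>.\<close>
  have M_orth: "(\<Sum>v<Suc q. M u v * M u' v) = (if u = u' then int q else 0)"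
    if "u < Suc q" "u' < Suc q" for u u'
    using that by (auto simp: M_def row orth less_Suc_eq)
  have P_orth: "(\<Sum>v<Suc q. P u v * P u' v) = (if u = u' then 1 else 0)"
    if "u < Suc q" "u' < Suc q" for u u'
    using that by (auto simp: P_def less_Suc_eq sum_N NN)
  have PM: "(\<Sum>v<Suc q. P u v * M u' v) + (\<Sum>v<Suc q. M u v * P u' v) = 0"
    if "u < Suc q" "u' < Suc q" for u u'
  proof (cases "u = q \<or> u' = q")
    \<comment> \<open>With exactly one border index, the corner \<open>-1\<close> of
      \<open>P\<close> meets the border entry \<open>1\<close> of \<open>M\<close>, and the row sum
      \<open>1\<close> of \<open>N\<close> compensates for it.\<close>
    case True
    then show ?thesis using that by (auto simp: P_def M_def less_Suc_eq sum_N sum_N' sum_N1 zero)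
  next
    case False
    then have uu: "u < q" "u' < q" using that by auto
    then show ?thesis using skew[OF uu] by (simp add: P_def M_def sum_N sum_N')
  qed
  have B_pm: "B x y \<in> {1, -1}" if "x < q" "y < q" for x y
    using pm[OF that] zero[OF that(1)] by (auto simp: B_def N_def)
  \<comment> \<open>Exactly one of \<open>P u v\<close> and \<open>M u v\<close> is nonzero, because
    \<open>N\<close> is supported precisely on the zeros of \<open>X\<close>.\<close>
  have h_pm: "h u x v y \<in> {1, -1}" if "u < Suc q" "v < Suc q" "x < q" "y < q" for u v x y
    using that B_pm[OF that(3,4)] pm[of u v] zero[of u]
    by (auto simp: h_def P_def M_def N_def less_Suc_eq)
  have h_sym: "h u x v y = h v y u x" if "u < Suc q" "v < Suc q" "x < q" "y < q" for u v x y
    using that sym[of x y] sym[of u v] N_sym[of x y] N_sym[of u v]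
    by (auto simp: h_def P_def M_def B_def less_Suc_eq)
  have h_orth: "(\<Sum>v<Suc q. \<Sum>y<q. h u x v y * h u' x' v y) =
      (if u = u' \<and> x = x' then int m else 0)"
    if "u < Suc q" "u' < Suc q" "x < q" "x' < q" for u u' x x'
  proof -
    have "(\<Sum>y<q. h u x v y * h u' x' v y) =
        int q * (P u v * P u' v) + (P u v * M u' v) * (\<Sum>y<q. B x' y)
        + (M u v * P u' v) * (\<Sum>y<q. B x y) + (M u v * M u' v) * (\<Sum>y<q. B x y * B x' y)" for v
      unfolding h_def by (simp add: algebra_simps sum.distrib sum_distrib_left)
    then have "(\<Sum>v<Suc q. \<Sum>y<q. h u x v y * h u' x' v y) =
        int q * (\<Sum>v<Suc q. P u v * P u' v)
        + ((\<Sum>v<Suc q. P u v * M u' v) + (\<Sum>v<Suc q. M u v * P u' v))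
        + (\<Sum>v<Suc q. M u v * M u' v) * ((if x = x' then int q + 1 else 0) - 1)"
      using that by (simp add: B_sum B_orth sum.distrib sum_distrib_left sum_distrib_right
          del: sum.lessThan_Suc)
    then show ?thesis
      unfolding P_orth[OF that(1,2)] PM[OF that(1,2)] M_orth[OF that(1,2)]
      by (cases "u = u'"; cases "x = x'") (simp_all add: m_def algebra_simps del: sum.lessThan_Suc)
  qed
  have bound: "i div q < Suc q \<and> i mod q < q" if "i < m" for i
    using that q by (simp add: m_def less_mult_imp_div_less mult.commute)
  have HH: "(\<Sum>l<m. H $$ (i, l) * H $$ (j, l)) = (if i = j then int m else 0)"
    if ij: "i < m" "j < m" for i j
  proof -
    have "(\<Sum>l<m. H $$ (i, l) * H $$ (j, l)) =
       (\<Sum>l<Suc q * q. h (i div q) (i mod q) (l div q) (l mod q) * h (j div q) (j mod q) (l div q) (l mod q))"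
      using ij by (intro sum.cong) (auto simp: H_def m_def)
    also have "\<dots> = (\<Sum>v<Suc q. \<Sum>y<q. h (i div q) (i mod q) v y * h (j div q) (j mod q) v y)"
      using q by (rule sum_div_mod)
    also have "\<dots> = (if i div q = j div q \<and> i mod q = j mod q then int m else 0)"
      using bound ij by (intro h_orth) auto
    also have "i div q = j div q \<and> i mod q = j mod q \<longleftrightarrow> i = j"
      by (metis div_mult_mod_eq)
    finally show ?thesis .
  qed
  have car: "H \<in> carrier_mat m m" by (simp add: H_def)
  have "H * transpose_mat H = int m \<cdot>\<^sub>m 1\<^sub>m m"
  proof (rule eq_matI)
    fix i j assume "i < dim_row (int m \<cdot>\<^sub>m 1\<^sub>m m)" "j < dim_col (int m \<cdot>\<^sub>m 1\<^sub>m m :: int mat)"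
    then have ij: "i < m" "j < m" by auto
    then have "(H * transpose_mat H) $$ (i, j) = (\<Sum>l<m. H $$ (i, l) * H $$ (j, l))"
      using car by (auto simp: scalar_prod_def lessThan_atLeast0 intro!: sum.cong)
    then show "(H * transpose_mat H) $$ (i, j) = (int m \<cdot>\<^sub>m 1\<^sub>m m) $$ (i, j)"
      using ij by (simp add: HH)
  qed (use car in auto)
  moreover have "H $$ (i, j) \<in> {1, -1}" if "i < m" "j < m" for i j
    using that h_pm bound[OF that(1)] bound[OF that(2)] unfolding H_def by simp
  moreover have "transpose_mat H = H"
    using h_sym bound by (auto simp: H_def)
  ultimately show ?thesis
    using car unfolding hadamard_mat_def m_def[symmetric] by blast
qed

section \<open>The finite field\<close>

text \<open>
  Multiplication by \<open>h(\<zeta>)\<close> acts on \<open>(1, \<zeta>, \<dots>, \<zeta>\<^sup>n\<^sup>-\<^sup>1)\<close> as an integral circulant matrix, so \<open>h(\<zeta>)\<close> is an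
  eigenvalue of it.
\<close>
lemma algebraic_int_poly_root_of_unity:
  fixes \<zeta> :: complex and h :: "int poly"
  assumes n: "n > 0" and \<zeta>: "\<zeta> ^ n = 1"
  shows "algebraic_int (poly (map_poly of_int h) \<zeta>)"
proof -
  let ?z = "poly (map_poly of_int h) \<zeta>"
  define C :: "int mat" where
    "C = mat n n (\<lambda>(i, j). \<Sum>e\<le>degree h. if (i + e) mod n = j then coeff h e else 0)"
  define v where "v = vec n (\<lambda>j. \<zeta> ^ j)"
  let ?C = "map_mat of_int C :: complex mat"
  have C: "C \<in> carrier_mat n n" by (simp add: C_def)
  have pow_mod: "\<zeta> ^ (a mod n) = \<zeta> ^ a" for a
  proof -
    have "\<zeta> ^ a = \<zeta> ^ (n * (a div n) + a mod n)" by simp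
    also have "\<dots> = \<zeta> ^ (a mod n)" unfolding power_add power_mult \<zeta> by simp
    finally show ?thesis by simp
  qed
  have "?C *\<^sub>v v = ?z \<cdot>\<^sub>v v"
  proof (rule eq_vecI)
    fix i assume "i < dim_vec (?z \<cdot>\<^sub>v v)"
    then have i: "i < n" by (simp add: v_def)
    have "(?C *\<^sub>v v) $ i = (\<Sum>j<n. of_int (C $$ (i, j)) * \<zeta> ^ j)"
      using i by (auto simp: scalar_prod_def v_def C_def lessThan_atLeast0 intro!: sum.cong)
    also have "\<dots> = (\<Sum>j<n. \<Sum>e\<le>degree h. if (i + e) mod n = j then of_int (coeff h e) * \<zeta> ^ j else 0)"
      using i by (intro sum.cong) (auto simp: C_def sum_distrib_right intro!: sum.cong)
    also have "\<dots> = (\<Sum>e\<le>degree h. \<Sum>j<n. if (i + e) mod n = j then of_int (coeff h e) * \<zeta> ^ j else 0)"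
      by (rule sum.swap)
    also have "\<dots> = (\<Sum>e\<le>degree h. of_int (coeff h e) * \<zeta> ^ (i + e))"
      using n by (intro sum.cong) (auto simp: pow_mod)
    also have "\<dots> = ?z * \<zeta> ^ i"
      by (simp add: poly_altdef sum_distrib_right sum_distrib_left power_add algebra_simps)
    finally show "(?C *\<^sub>v v) $ i = (?z \<cdot>\<^sub>v v) $ i" using i by (simp add: v_def)
  qed (auto simp: C_def v_def)
  moreover have "v \<noteq> 0\<^sub>v n"
    using n by (metis index_vec index_zero_vec(1) power_0 v_def zero_neq_one)
  ultimately have "eigenvalue ?C ?z"
    unfolding eigenvalue_def eigenvector_def using C by (intro exI[of _ v]) (auto simp: v_def)
  then have "poly (char_poly ?C) ?z = 0"
    using eigenvalue_root_char_poly[of ?C n] C by auto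
  \<comment> \<open>The characteristic polynomial of \<open>C\<close> is monic with integer
    coefficients, so each of its complex roots is an algebraic integer.\<close>
  then have "poly (map_poly of_int (char_poly C)) ?z = 0"
    using of_int_hom.char_poly_hom[OF C] by metis
  then show ?thesis
    using degree_monic_char_poly[OF C] unfolding algebraic_int_altdef_ipoly by auto
qed

section \<open>Maximal ideals\<close>

definition ring_ideal :: "'a::comm_ring_1 set \<Rightarrow> bool" where
  "ring_ideal I \<longleftrightarrow> 0 \<in> I \<and> (\<forall>a\<in>I. \<forall>b\<in>I. a + b \<in> I) \<and> (\<forall>a\<in>I. \<forall>r. r * a \<in> I)"

text \<open>Zorn's lemma applies to the proper ideals above \<open>J\<close>. Maximality is
  delivered as invertibility modulo \<open>I\<close>, the form in which the quotient acts as a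
  field.\<close>

lemma ex_maximal_ideal:
  fixes J :: "'a::comm_ring_1 set"
  assumes J: "ring_ideal J" "1 \<notin> J"
  obtains I where "ring_ideal I" "J \<subseteq> I" "1 \<notin> I" "\<And>f. f \<notin> I \<Longrightarrow> \<exists>g. f * g - 1 \<in> I"
proof -
  let ?A = "{I. ring_ideal I \<and> J \<subseteq> I \<and> 1 \<notin> I}"
  \<comment> \<open>The union bounds a nonempty chain; the empty chain is bounded by
    \<open>J\<close>.\<close>
  have "\<exists>U\<in>?A. \<forall>X\<in>c. X \<subseteq> U" if c: "subset.chain ?A c" for c
  proof (cases "c = {}")
    case True
    then show ?thesis using J by auto
  next
    case False
    have cA: "c \<subseteq> ?A" and tot: "\<And>x y. x \<in> c \<Longrightarrow> y \<in> c \<Longrightarrow> x \<subseteq> y \<or> y \<subseteq> x"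
      using c unfolding subset.chain_def by auto
    have "ring_ideal (\<Union>c)"
      unfolding ring_ideal_def
    proof (intro conjI ballI allI)
      show "0 \<in> \<Union>c" using False cA by (auto simp: ring_ideal_def)
      fix a assume "a \<in> \<Union>c"
      then obtain x where x: "x \<in> c" "a \<in> x" by blast
      then have ix: "ring_ideal x" using cA by blast
      then show "r * a \<in> \<Union>c" for r using x unfolding ring_ideal_def by blast
      fix b assume "b \<in> \<Union>c"
      then obtain y where y: "y \<in> c" "b \<in> y" by blast
      then have iy: "ring_ideal y" using cA by blast
      show "a + b \<in> \<Union>c"
        using tot[OF x(1) y(1)] x y ix iy unfolding ring_ideal_def by blast
    qed
    then show ?thesis using False cA by (intro bexI[of _ "\<Union>c"]) auto
  qed
  then have "\<exists>M\<in>?A. \<forall>X\<in>?A. M \<subseteq> X \<longrightarrow> X = M" by (rule subset_Zorn)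
  then obtain I where I: "I \<in> ?A" and max: "\<And>X. X \<in> ?A \<Longrightarrow> I \<subseteq> X \<Longrightarrow> X = I"
    by (elim bexE) simp
  have iI: "ring_ideal I" using I by blast
  have "\<exists>g. f * g - 1 \<in> I" if f: "f \<notin> I" for f
  proof -
    \<comment> \<open>\<open>?K\<close> is the ideal generated by \<open>I\<close> and
      \<open>f\<close>; being strictly larger than \<open>I\<close>, it must contain
      \<open>1\<close>.\<close>
    let ?K = "{a + f * g | a g. a \<in> I}"
    have memb: "y \<in> ?K" if "y = a + f * g" "a \<in> I" for y a g using that by blast
    have "ring_ideal ?K"
      unfolding ring_ideal_def
    proof (intro conjI ballI allI)
      show "0 \<in> ?K" by (rule memb[of _ 0 0]) (use iI in \<open>auto simp: ring_ideal_def\<close>)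
      fix y assume "y \<in> ?K"
      then obtain a g where y: "y = a + f * g" "a \<in> I" by blast
      show "r * y \<in> ?K" for r
        by (rule memb[of _ "r * a" "r * g"]) (use y iI in \<open>auto simp: ring_ideal_def algebra_simps\<close>)
      fix z assume "z \<in> ?K"
      then obtain b h where z: "z = b + f * h" "b \<in> I" by blast
      show "y + z \<in> ?K"
        by (rule memb[of _ "a + b" "g + h"]) (use y z iI in \<open>auto simp: ring_ideal_def algebra_simps\<close>)
    qed
    moreover have "I \<subseteq> ?K" using memb[of _ _ 0] by auto
    moreover have "f \<in> ?K" by (rule memb[of _ 0 1]) (use iI in \<open>auto simp: ring_ideal_def\<close>)
    ultimately have "1 \<in> ?K" using max[of ?K] I f by blast
    then obtain a g where "1 = a + f * g" "a \<in> I" by blast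
    then have "f * g - 1 = (-1) * a" by (simp add: algebra_simps)
    then show ?thesis using iI \<open>a \<in> I\<close> unfolding ring_ideal_def by metis
  qed
  then show thesis using that[of I] I by blast
qed

section \<open>Binomial powers and roots of unity\<close>

text \<open>The inner binomial coefficients are divisible by \<open>p\<close>. The explicit
  remainder makes the Frobenius identity usable modulo any ideal containing
  \<open>p\<close>.\<close>

lemma prime_dvd_binomial_power:
  fixes a b :: "'a::comm_ring_1"
  assumes p: "prime p"
  shows "\<exists>c. (a + b) ^ p = a ^ p + b ^ p + of_nat p * c"
proof -
  have p1: "p > 1" using p by (rule prime_gt_1_nat)
  have "\<exists>d. of_nat (p choose j) * a ^ j * b ^ (p - j) = of_nat p * d" if "j \<in> {1..<p}" for j
  proof -
    have "p dvd p choose j" using that p by (intro dvd_choose_prime) auto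
    then obtain e where "p choose j = p * e" by (elim dvdE)
    then show ?thesis by (intro exI[of _ "of_nat e * a ^ j * b ^ (p - j)"]) (simp add: mult.assoc)
  qed
  then obtain d where d: "\<And>j. j \<in> {1..<p} \<Longrightarrow> of_nat (p choose j) * a ^ j * b ^ (p - j) = of_nat p * d j"
    by metis
  have "{..p} = insert 0 (insert p {1..<p})" using p1 by auto
  then have "(a + b) ^ p = b ^ p + (a ^ p + (\<Sum>j\<in>{1..<p}. of_nat (p choose j) * a ^ j * b ^ (p - j)))"
    unfolding binomial_ring using p1 by simp
  also have "(\<Sum>j\<in>{1..<p}. of_nat (p choose j) * a ^ j * b ^ (p - j)) = of_nat p * (\<Sum>j\<in>{1..<p}. d j)"
    using d by (simp add: sum_distrib_left)
  finally show ?thesis by (metis add.assoc add.commute)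
qed

text \<open>Both sides are values of monic polynomials of degree \<open>n\<close>; a nonzero
  difference would have degree below \<open>n\<close> but vanish at all \<open>n\<close> roots of
  unity.\<close>

lemma prod_roots_of_unity:
  fixes z :: complex
  assumes n: "n > 0"
  shows "(\<Prod>j<n. z - cis (2 * pi * real j / real n)) = z ^ n - 1"
proof -
  let ?r = "\<lambda>j. cis (2 * pi * real j / real n)"
  let ?f = "(\<Prod>j<n. [:- ?r j, 1:]) :: complex poly"
  let ?g = "monom 1 n - 1 :: complex poly"
  have bij: "bij_betw ?r {..<n} {z. z ^ n = 1}" using Complex.bij_betw_roots_unity[OF n] .
  have "?f = ?g"
  proof (rule ccontr)
    assume ne: "?f \<noteq> ?g"
    have lf: "degree ?f = n" "coeff ?f n = 1"
    proof -
      show d: "degree ?f = n" by (subst degree_prod_sum_eq) auto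
      have "lead_coeff ?f = 1" by (simp add: lead_coeff_prod)
      then show "coeff ?f n = 1" using d by simp
    qed
    have "degree (?f - ?g) < n"
    proof (intro le_neq_implies_less)
      show "degree (?f - ?g) \<le> n"
        using lf by (intro degree_diff_le) (auto intro: degree_monom_le)
      have "coeff (?f - ?g) n = 0" using lf n by (simp add: coeff_eq_0)
      then show "degree (?f - ?g) \<noteq> n"
        using ne n by (metis degree_0 leading_coeff_0_iff right_minus_eq)
    qed
    moreover have "{z. z ^ n = 1} \<subseteq> {z. poly (?f - ?g) z = 0}"
    proof
      fix z :: complex assume "z \<in> {z. z ^ n = 1}"
      then obtain j where "j < n" "z = ?r j" "z ^ n = 1"
        using bij unfolding bij_betw_def by blast
      then show "z \<in> {z. poly (?f - ?g) z = 0}"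
        by (auto simp: poly_prod poly_monom)
    qed
    then have "card {z::complex. z ^ n = 1} \<le> card {z. poly (?f - ?g) z = 0}"
      using ne by (intro card_mono poly_roots_finite) auto
    moreover have "card {z::complex. z ^ n = 1} = n" by (rule Complex.card_roots_unity_eq[OF n])
    moreover have "card {z. poly (?f - ?g) z = 0} \<le> degree (?f - ?g)"
      using ne by (intro card_poly_roots_bound) auto
    ultimately show False by simp
  qed
  then have "poly ?f z = poly ?g z" by simp
  then show ?thesis by (simp add: poly_prod poly_monom)
qed

text \<open>
  \<open>\<int>[\<zeta>]\<close> is represented by integer polynomials, \<open>kernel\<close> identifying those with the same value
  at \<open>\<zeta>\<close>.
\<close>
locale cyclotomic_residue_field =
  fixes p k n :: nat and I :: "int poly set"
  assumes prime_p: "prime p"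
    and Suc_n: "Suc n = p ^ k"
    and n_mod_4: "n mod 4 = 2"
    and ideal: "ring_ideal I"
    and proper: "1 \<notin> I"
    and maximal: "\<And>f. f \<notin> I \<Longrightarrow> \<exists>g. f * g - 1 \<in> I"
    and p_in: "of_nat p \<in> I"
    and kernel: "\<And>f. poly (map_poly of_int f) (cis (2 * pi / real n)) = 0 \<Longrightarrow> f \<in> I"
begin

section \<open>Arithmetic modulo the ideal\<close>

text \<open>The quotient type is never formed: \<open>\<approx>\<close> serves as equality in the
  residue field.\<close>

definition cong (infix "\<approx>" 50) where "f \<approx> g \<longleftrightarrow> f - g \<in> I"

definition x :: "int poly" where "x = [:0, 1:]"

definition \<zeta> :: complex where "\<zeta> = cis (2 * pi / real n)"

abbreviation ev :: "int poly \<Rightarrow> complex" where "ev f \<equiv> poly (map_poly of_int f) \<zeta>"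

lemma zero_in: "0 \<in> I"
  and add_in: "a \<in> I \<Longrightarrow> b \<in> I \<Longrightarrow> a + b \<in> I"
  and mult_in: "a \<in> I \<Longrightarrow> r * a \<in> I"
  using ideal unfolding ring_ideal_def by blast+

lemma mult_in': "a \<in> I \<Longrightarrow> a * r \<in> I"
  using mult_in[of a r] by (simp add: mult.commute)

lemma uminus_in: "a \<in> I \<Longrightarrow> - a \<in> I"
  using mult_in[of a "-1"] by simp

lemma diff_in: "a \<in> I \<Longrightarrow> b \<in> I \<Longrightarrow> a - b \<in> I"
  using add_in[of a "- b"] uminus_in[of b] by simp

lemma cong_refl [simp]: "f \<approx> f"
  by (simp add: cong_def zero_in)

lemma cong_sym: "f \<approx> g \<Longrightarrow> g \<approx> f"
  unfolding cong_def using uminus_in[of "f - g"] by simp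

lemma cong_trans [trans]: "f \<approx> g \<Longrightarrow> g \<approx> h \<Longrightarrow> f \<approx> h"
  unfolding cong_def using add_in[of "f - g" "g - h"] by simp

lemma cong_add: "a \<approx> b \<Longrightarrow> c \<approx> d \<Longrightarrow> a + c \<approx> b + d"
  unfolding cong_def using add_in[of "a - b" "c - d"] by (simp add: algebra_simps)

lemma cong_diff: "a \<approx> b \<Longrightarrow> c \<approx> d \<Longrightarrow> a - c \<approx> b - d"
  unfolding cong_def using diff_in[of "a - b" "c - d"] by (simp add: algebra_simps)

lemma cong_mult: "a \<approx> b \<Longrightarrow> c \<approx> d \<Longrightarrow> a * c \<approx> b * d"
  unfolding cong_def
  using add_in[OF mult_in'[of "a - b" c] mult_in[of "c - d" b]] by (simp add: algebra_simps)

lemma cong_power: "a \<approx> b \<Longrightarrow> a ^ m \<approx> b ^ m"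
  by (induction m) (auto intro: cong_mult)

lemma cong_in_iff: "a \<approx> b \<Longrightarrow> a \<in> I \<longleftrightarrow> b \<in> I"
  unfolding cong_def using add_in[of "a - b" b] diff_in[of a "a - b"] by auto

lemma cong_0_iff: "f \<approx> 0 \<longleftrightarrow> f \<in> I"
  by (simp add: cong_def)

lemma prime_ideal: "f * g \<in> I \<Longrightarrow> f \<in> I \<or> g \<in> I"
proof (rule ccontr)
  assume fg: "f * g \<in> I" and "\<not> (f \<in> I \<or> g \<in> I)"
  then obtain h where h: "f * h - 1 \<in> I" and g: "g \<notin> I" using maximal by blast
  \<comment> \<open>This difference equals \<open>g\<close>.\<close>
  have "h * (f * g) - (f * h - 1) * g \<in> I"
    using mult_in[OF fg] mult_in'[OF h] by (rule diff_in)
  then show False using g by (simp add: algebra_simps)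
qed

lemma mult_in_iff: "f * g \<in> I \<longleftrightarrow> f \<in> I \<or> g \<in> I"
  using prime_ideal mult_in mult_in' by blast

lemma prime_ideal_prod: "finite A \<Longrightarrow> (\<Prod>a\<in>A. f a) \<in> I \<Longrightarrow> \<exists>a\<in>A. f a \<in> I"
  by (induction A rule: finite_induct) (use proper mult_in_iff in auto)

lemma cong_cancel: "a \<notin> I \<Longrightarrow> a * f \<approx> a * g \<Longrightarrow> f \<approx> g"
  unfolding cong_def using prime_ideal[of a "f - g"] by (simp add: algebra_simps)

text \<open>This transfers identities between complex numbers to the residue field.\<close>

lemma ev_cong: "ev f = ev g \<Longrightarrow> f \<approx> g"
  unfolding cong_def by (rule kernel) (simp add: of_int_poly_hom.hom_minus flip: \<zeta>_def)

section \<open>Powers of the root of unity\<close>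

lemma n_pos: "n > 0" and n_even: "even n" and half_odd: "odd (n div 2)"
  using n_mod_4 by presburger+

lemma ev_x: "ev x = \<zeta>"
  by (simp add: x_def of_int_hom.map_poly_pCons_hom)

lemma ev_power: "ev (f ^ m) = ev f ^ m"
  by (simp add: of_int_poly_hom.hom_power)

lemma zeta_power: "\<zeta> ^ a = cis (2 * pi * real a / real n)"
  by (simp add: \<zeta>_def DeMoivre mult_ac)

lemma zeta_n: "\<zeta> ^ n = 1"
  using n_pos by (simp add: zeta_power)

lemma x_n: "x ^ n \<approx> 1"
  by (rule ev_cong) (simp add: ev_power ev_x zeta_n)

text \<open>Half a turn on the unit circle is \<open>-1\<close>. As \<open>n div 2\<close> is odd,
  \<open>-1\<close> becomes an odd power of \<open>x\<close>, which later gives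
  \<open>\<chi> (-1) = -1\<close>.\<close>

lemma x_half: "x ^ (n div 2) \<approx> -1"
proof (rule ev_cong)
  have "2 * pi * real (n div 2) / real n = pi"
    using n_even n_pos by (auto elim!: evenE)
  then show "ev (x ^ (n div 2)) = ev (-1)"
    by (simp add: ev_power ev_x zeta_power of_int_poly_hom.hom_uminus)
qed

lemma x_power_notin: "x ^ a \<notin> I"
proof
  assume "x ^ a \<in> I"
  then have "x \<in> I" by (induction a) (use proper mult_in_iff in auto)
  then have "x ^ n \<in> I" using n_pos by (cases n) (auto intro: mult_in')
  then show False using cong_in_iff[OF x_n] proper by simp
qed

lemma power_p_k_in: "of_nat (p ^ k) \<in> I"
proof -
  have "k \<noteq> 0" using Suc_n n_pos by (cases k) auto
  then obtain k' where "k = Suc k'" using not0_implies_Suc by blast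
  then show ?thesis using mult_in'[OF p_in] by simp
qed

text \<open>Modulo \<open>I\<close> the number \<open>n\<close> is \<open>-1\<close>, since
  \<open>Suc n = p ^ k\<close> lies in \<open>I\<close>.\<close>

lemma n_notin: "of_nat n \<notin> I"
proof
  assume "of_nat n \<in> I"
  then have "of_nat (p ^ k) - of_nat n \<in> I" using power_p_k_in by (intro diff_in)
  then show False using proper unfolding Suc_n[symmetric] by simp
qed

text \<open>The geometric sum of the powers of \<open>\<zeta> ^ i\<close> is zero, whereas
  \<open>x ^ i \<approx> 1\<close> would make its residue equal to \<open>n\<close>, which is
  nonzero modulo \<open>I\<close>.\<close>

lemma x_power_neq_1:
  assumes i: "0 < i" "i < n"
  shows "\<not> x ^ i \<approx> 1"
proof
  assume eq: "x ^ i \<approx> 1"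
  have ne: "\<zeta> ^ i \<noteq> 1"
  proof
    assume "\<zeta> ^ i = 1"
    then have "cis (2 * pi * real i / real n) = cis (2 * pi * real 0 / real n)"
      by (simp add: zeta_power)
    then show False
      using Complex.bij_betw_roots_unity[OF n_pos] i n_pos
      unfolding bij_betw_def inj_on_def by (metis lessThan_iff less_irrefl)
  qed
  have "(\<zeta> ^ i - 1) * (\<Sum>j<n. (\<zeta> ^ i) ^ j) = (\<zeta> ^ i) ^ n - 1"
    by (rule power_diff_1_eq[symmetric])
  also have "(\<zeta> ^ i) ^ n = 1"
    using zeta_n by (metis mult.commute power_mult power_one)
  finally have "(\<Sum>j<n. (\<zeta> ^ i) ^ j) = 0" using ne by simp
  then have "ev (\<Sum>j<n. (x ^ i) ^ j) = 0"
    by (simp add: of_int_poly_hom.hom_sum poly_sum ev_power ev_x)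
  then have *: "(\<Sum>j<n. (x ^ i) ^ j) \<in> I" unfolding \<zeta>_def by (rule kernel)
  have "(\<Sum>j<m. (x ^ i) ^ j) \<approx> of_nat m" for m
  proof (induction m)
    case (Suc m)
    then show ?case
      using cong_add[OF Suc cong_power[OF eq, of m]] by (simp add: add.commute)
  qed simp
  from cong_in_iff[OF this[of n]] * n_notin show False by simp
qed

lemma x_power_mod: "x ^ (a mod n) \<approx> x ^ a"
proof -
  have "x ^ (n * (a div n)) * x ^ (a mod n) \<approx> 1 ^ (a div n) * x ^ (a mod n)"
    unfolding power_mult by (intro cong_mult cong_power x_n cong_refl)
  then show ?thesis by (simp add: cong_sym flip: power_add)
qed

lemma x_power_cong_1:
  assumes "x ^ a \<approx> 1"
  shows "n dvd a"
proof -
  have "x ^ (a mod n) \<approx> 1" using x_power_mod assms by (rule cong_trans)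
  then have "a mod n = 0" using x_power_neq_1[of "a mod n"] n_pos by fastforce
  then show ?thesis by blast
qed

lemma x_power_cong_imp:
  assumes "x ^ a \<approx> x ^ b"
  shows "a mod n = b mod n"
proof -
  have *: "a mod n = b mod n" if "x ^ a \<approx> x ^ b" "a \<le> b" for a b
  proof -
    have "x ^ a * x ^ (b - a) \<approx> x ^ a * 1"
      using cong_sym[OF that(1)] that(2) by (simp flip: power_add)
    then have "n dvd b - a" using cong_cancel[OF x_power_notin] x_power_cong_1 by blast
    then show ?thesis using that(2) by (metis mod_eq_dvd_iff_nat)
  qed
  show ?thesis using *[of a b] *[of b a] assms cong_sym linear by metis
qed

section \<open>Frobenius and the generator of the nonzero residues\<close>

lemma frobenius_add: "(f + g) ^ (p ^ j) \<approx> f ^ (p ^ j) + g ^ (p ^ j)"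
proof (induction j)
  case (Suc j)
  have "(f + g) ^ (p ^ Suc j) = ((f + g) ^ (p ^ j)) ^ p"
    by (simp add: mult.commute flip: power_mult)
  also have "\<dots> \<approx> (f ^ (p ^ j) + g ^ (p ^ j)) ^ p" by (rule cong_power[OF Suc])
  also have "\<dots> \<approx> (f ^ (p ^ j)) ^ p + (g ^ (p ^ j)) ^ p"
    using prime_dvd_binomial_power[OF prime_p, of "f ^ (p ^ j)" "g ^ (p ^ j)"] mult_in'[OF p_in]
    by (auto simp: cong_def)
  also have "\<dots> = f ^ (p ^ Suc j) + g ^ (p ^ Suc j)"
    by (simp add: mult.commute flip: power_mult)
  finally show ?case .
qed simp

text \<open>The fixed elements are closed under sums and products and contain the constants and
  \<open>x\<close>, hence every polynomial.\<close>

lemma frobenius_fixed: "f ^ (p ^ k) \<approx> f"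
proof -
  define S where "S = {f. f ^ (p ^ k) \<approx> f}"
  have add: "f + g \<in> S" if "f \<in> S" "g \<in> S" for f g
    using that cong_trans[OF frobenius_add cong_add] by (simp add: S_def)
  have mult: "f * g \<in> S" if "f \<in> S" "g \<in> S" for f g
    using that by (auto simp: S_def power_mult_distrib intro: cong_mult)
  \<comment> \<open>Oddness of the exponent fixes \<open>-1\<close>, from which the negative
    constants follow.\<close>
  have "odd (p ^ k)" using n_even unfolding Suc_n[symmetric] by simp
  then have units: "0 \<in> S" "1 \<in> S" "-1 \<in> S"
    using n_pos unfolding S_def by (auto simp flip: Suc_n)
  have const: "of_int a \<in> S" for a
  proof (induction a rule: int_induct[where k = 0])
    case (step2 i)
    then show ?case using add[of "of_int i" "-1"] units by simp
  qed (use add[of _ 1] units in auto)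
  have "x ^ n * x \<approx> 1 * x" by (intro cong_mult x_n cong_refl)
  then have x: "x \<in> S" unfolding S_def by (simp add: mult.commute flip: Suc_n)
  have "f \<in> S"
  proof (induction f)
    case (pCons a f)
    have "pCons a f = of_int a + x * f"
      by (simp add: x_def of_int_poly)
    then show ?case using add[OF const mult[OF x pCons(2)]] by simp
  qed (use units in simp)
  then show ?thesis by (simp add: S_def)
qed

lemma ex_x_power:
  assumes "f \<notin> I"
  shows "\<exists>i<n. f \<approx> x ^ i"
proof -
  have "f * f ^ n \<approx> f * 1"
    using frobenius_fixed[of f] by (simp flip: Suc_n)
  then have "f ^ n \<approx> 1" by (rule cong_cancel[OF assms])
  then have "f ^ n - 1 \<in> I" by (simp add: cong_def)
  \<comment> \<open>The factorisation holds for the complex number \<open>ev f\<close> and is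
    carried over by \<open>ev_cong\<close>; primality of \<open>I\<close> then singles out a
    factor.\<close>
  moreover have "(\<Prod>i<n. f - x ^ i) \<approx> f ^ n - 1"
    by (rule ev_cong)
      (simp add: of_int_poly_hom.hom_prod of_int_poly_hom.hom_minus of_int_poly_hom.hom_power
        poly_prod ev_power ev_x zeta_power prod_roots_of_unity[OF n_pos, symmetric])
  ultimately have "(\<Prod>i<n. f - x ^ i) \<in> I" using cong_in_iff by blast
  then show ?thesis using prime_ideal_prod[of "{..<n}"] by (auto simp: cong_def)
qed

section \<open>The quadratic character\<close>

definition \<chi> :: "int poly \<Rightarrow> int" where
  "\<chi> f = (if f \<in> I then 0 else if \<exists>a. even a \<and> f \<approx> x ^ a then 1 else -1)"

lemma \<chi>_cong:
  assumes "f \<approx> g"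
  shows "\<chi> f = \<chi> g"
proof -
  have "f \<approx> h \<longleftrightarrow> g \<approx> h" for h
    using cong_trans[OF assms] cong_trans[OF cong_sym[OF assms]] by blast
  then show ?thesis using cong_in_iff[OF assms] by (simp add: \<chi>_def)
qed

text \<open>Exponents of \<open>x\<close> are determined modulo \<open>n\<close>, and
  \<open>n\<close> is even, so their parity is well defined.\<close>

lemma \<chi>_x_power: "\<chi> (x ^ a) = (-1) ^ a"
proof -
  have "even b \<longleftrightarrow> even a" if "x ^ a \<approx> x ^ b" for b
    using x_power_cong_imp[OF that] n_even by (metis dvd_mod_iff)
  then show ?thesis
    unfolding \<chi>_def using x_power_notin by (cases "even a") (auto intro: cong_refl)
qed

lemma \<chi>_eq_0_iff: "\<chi> f = 0 \<longleftrightarrow> f \<in> I"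
  by (simp add: \<chi>_def)

lemma \<chi>_values: "f \<notin> I \<Longrightarrow> \<chi> f \<in> {1, -1}"
  by (simp add: \<chi>_def)

lemma \<chi>_mult: "\<chi> (f * g) = \<chi> f * \<chi> g"
proof (cases "f \<in> I \<or> g \<in> I")
  case True
  then have "f * g \<in> I" by (simp add: mult_in_iff)
  then show ?thesis using True \<chi>_eq_0_iff by (metis mult_eq_0_iff)
next
  case False
  then obtain a b where ab: "f \<approx> x ^ a" "g \<approx> x ^ b" using ex_x_power by blast
  then have "f * g \<approx> x ^ (a + b)" by (simp add: power_add cong_mult)
  then show ?thesis using ab[THEN \<chi>_cong] \<chi>_cong[of "f * g" "x ^ (a + b)"]
    by (simp add: \<chi>_x_power) (simp add: power_add)
qed

lemma \<chi>_uminus: "\<chi> (- f) = - \<chi> f"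
proof -
  have "\<chi> (-1) = -1"
    using \<chi>_cong[OF x_half] half_odd by (simp add: \<chi>_x_power)
  then show ?thesis using \<chi>_mult[of "-1" f] by simp
qed

section \<open>Enumeration of the field and character sums\<close>

text \<open>Matrix indices below \<open>Suc n\<close> run through the residues: index
  \<open>0\<close> is zero, and the powers of \<open>x\<close> are shifted by one.\<close>

definition e :: "nat \<Rightarrow> int poly" where "e j = (if j = 0 then 0 else x ^ (j - 1))"

lemma e_0: "e 0 = 0" and e_Suc: "e (Suc a) = x ^ a"
  by (simp_all add: e_def)

lemma e_inj: "i < Suc n \<Longrightarrow> j < Suc n \<Longrightarrow> e i \<approx> e j \<Longrightarrow> i = j"
proof (cases i; cases j)
  fix a b assume "i < Suc n" "j < Suc n" "e i \<approx> e j" "i = Suc a" "j = Suc b"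
  then show "i = j" using x_power_cong_imp[of a b] by (simp add: e_Suc)
qed (auto simp: e_0 e_Suc cong_0_iff x_power_notin dest: cong_sym)

lemma ex_e: "\<exists>j<Suc n. f \<approx> e j"
proof (cases "f \<in> I")
  case True
  then show ?thesis by (intro exI[of _ 0]) (simp add: e_0 cong_0_iff)
next
  case False
  then show ?thesis using ex_x_power[of f] by (auto simp: e_Suc intro: exI[of _ "Suc _"])
qed

definition idx :: "int poly \<Rightarrow> nat" where "idx f = (SOME j. j < Suc n \<and> f \<approx> e j)"

lemma idx_less: "idx f < Suc n" and cong_e_idx: "f \<approx> e (idx f)"
  using someI_ex[OF ex_e[of f]] unfolding idx_def by auto

text \<open>An injective self-map of a finite set is a permutation; \<open>idx\<close> turns
  \<open>\<phi>\<close> into such a map on the indices.\<close>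

lemma sum_reindex:
  fixes F :: "int poly \<Rightarrow> int"
  assumes F: "\<And>f g. f \<approx> g \<Longrightarrow> F f = F g"
    and \<phi>: "\<And>f g. \<phi> f \<approx> \<phi> g \<Longrightarrow> f \<approx> g"
  shows "(\<Sum>j<Suc n. F (\<phi> (e j))) = (\<Sum>j<Suc n. F (e j))"
proof -
  have "inj_on (\<lambda>j. idx (\<phi> (e j))) {..<Suc n}"
  proof (rule inj_onI)
    fix i j assume ij: "i \<in> {..<Suc n}" "j \<in> {..<Suc n}" "idx (\<phi> (e i)) = idx (\<phi> (e j))"
    then have "\<phi> (e i) \<approx> \<phi> (e j)"
      using cong_e_idx[of "\<phi> (e i)"] cong_sym[OF cong_e_idx[of "\<phi> (e j)"]] cong_trans by metis
    then show "i = j" using ij \<phi> e_inj by auto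
  qed
  moreover have "(\<lambda>j. idx (\<phi> (e j))) ` {..<Suc n} \<subseteq> {..<Suc n}" using idx_less by auto
  ultimately have "bij_betw (\<lambda>j. idx (\<phi> (e j))) {..<Suc n} {..<Suc n}"
    by (simp add: bij_betw_def endo_inj_surj)
  then have "(\<Sum>j<Suc n. F (e (idx (\<phi> (e j))))) = (\<Sum>j<Suc n. F (e j))"
    by (rule sum.reindex_bij_betw)
  moreover have "F (e (idx (\<phi> (e j)))) = F (\<phi> (e j))" for j
    by (rule F[OF cong_e_idx, symmetric])
  ultimately show ?thesis by simp
qed

lemma \<chi>_sum: "(\<Sum>j<Suc n. \<chi> (e j)) = 0"
proof -
  have alt: "(\<Sum>a<2 * m. (-1) ^ a) = (0 :: int)" for m :: nat
    by (induction m) auto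
  have "(\<Sum>j<Suc n. \<chi> (e j)) = (\<Sum>a<n. (-1) ^ a)"
    by (subst sum.lessThan_Suc_shift) (simp add: e_0 e_Suc \<chi>_x_power \<chi>_eq_0_iff[THEN iffD2] zero_in)
  then show ?thesis using alt[of "n div 2"] n_even by simp
qed

lemma \<chi>_square_sum: "(\<Sum>j<Suc n. \<chi> (e j) * \<chi> (e j)) = int n"
  by (subst sum.lessThan_Suc_shift)
    (simp add: e_0 e_Suc \<chi>_x_power \<chi>_eq_0_iff[THEN iffD2] zero_in flip: power_add mult_2)

text \<open>For nonzero \<open>y\<close> the summand is \<open>\<chi>(1 + d/y)\<close>. As
  \<open>y\<close> varies, \<open>1 + d/y\<close> meets every residue except \<open>1\<close>, so
  the sum is the full character sum \<open>0\<close> minus \<open>\<chi> 1\<close>.\<close>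

lemma \<chi>_correlation:
  assumes d: "d \<notin> I"
  shows "(\<Sum>j<Suc n. \<chi> (e j) * \<chi> (e j + d)) = -1"
proof -
  \<comment> \<open>The factor \<open>x * x ^ (n - Suc a)\<close> is the inverse of
    \<open>x ^ a\<close>; splitting off one \<open>x\<close> leaves an exponent below
    \<open>n\<close>, so the sum can be reversed.\<close>
  have term_eq: "\<chi> (x ^ a) * \<chi> (x ^ a + d) = \<chi> (1 + d * x * x ^ (n - Suc a))" if "a < n" for a
  proof -
    have "x ^ a * (1 + d * x * x ^ (n - Suc a)) = x ^ a + d * x ^ (a + Suc (n - Suc a))"
      by (simp add: algebra_simps power_add)
    also have "a + Suc (n - Suc a) = n" using that by simp
    also have "x ^ a + d * x ^ n \<approx> x ^ a + d * 1"
      by (intro cong_add cong_mult x_n cong_refl)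
    finally have "\<chi> (x ^ a + d) = \<chi> (x ^ a) * \<chi> (1 + d * x * x ^ (n - Suc a))"
      by (metis \<chi>_cong \<chi>_mult mult.right_neutral)
    then show ?thesis by (simp add: \<chi>_x_power flip: mult.assoc power_add mult_2)
  qed
  have "(\<Sum>j<Suc n. \<chi> (e j) * \<chi> (e j + d)) = (\<Sum>a<n. \<chi> (x ^ a) * \<chi> (x ^ a + d))"
    by (subst sum.lessThan_Suc_shift) (simp add: e_0 e_Suc \<chi>_eq_0_iff[THEN iffD2] zero_in)
  also have "\<dots> = (\<Sum>a<n. \<chi> (1 + d * x * x ^ (n - Suc a)))"
    by (intro sum.cong) (auto simp: term_eq)
  also have "\<dots> = (\<Sum>a<n. \<chi> (1 + d * x * x ^ a))"
    by (rule sum.nat_diff_reindex)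
  \<comment> \<open>The subtracted \<open>\<chi> 1\<close> is the added term for
    \<open>e 0 = 0\<close>.\<close>
  also have "\<dots> = (\<Sum>j<Suc n. \<chi> (1 + d * x * e j)) - \<chi> 1"
    by (subst sum.lessThan_Suc_shift) (simp add: e_0 e_Suc)
  also have "(\<Sum>j<Suc n. \<chi> (1 + d * x * e j)) = (\<Sum>j<Suc n. \<chi> (e j))"
  proof (rule sum_reindex[OF \<chi>_cong])
    fix f g assume "1 + d * x * f \<approx> 1 + d * x * g"
    then have "d * x * f \<approx> d * x * g" by (simp add: cong_def)
    moreover have "d * x \<notin> I" using d x_power_notin[of 1] by (simp add: mult_in_iff)
    ultimately show "f \<approx> g" using cong_cancel by blast
  qed
  also have "\<chi> 1 = 1" using \<chi>_x_power[of 0] by simp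
  finally show ?thesis by (simp only: \<chi>_sum)
qed

lemma sum_shift:
  fixes F :: "int poly \<Rightarrow> int"
  assumes "\<And>f g. f \<approx> g \<Longrightarrow> F f = F g"
  shows "(\<Sum>j<Suc n. F (h + e j)) = (\<Sum>j<Suc n. F (e j))"
  by (rule sum_reindex[OF assms]) (auto simp: cong_def)

lemma symmetric_hadamard: "\<exists>H. hadamard_mat (Suc n * (1 + Suc n)) H \<and> transpose_mat H = H"
proof (rule symmetric_hadamard_from_core[where X = "\<lambda>i j. \<chi> (e i + e j)" and \<nu> = "\<lambda>i. idx (- e i)"])
  have idx_eq: "idx f = j" if "j < Suc n" "f \<approx> e j" for f j
    using e_inj[OF idx_less that(1)] cong_trans[OF cong_sym[OF cong_e_idx] that(2)] by blast
  have nu_cong: "h + e (idx (- f)) \<approx> h - f" for h f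
    using cong_add[OF cong_refl cong_sym[OF cong_e_idx[of "- f"]], of h] by simp
  show "0 < Suc n" by simp
  show "\<chi> (e i + e j) = \<chi> (e j + e i)" for i j by (simp add: add.commute)
  show "idx (- e i) < Suc n" for i by (rule idx_less)
  show "idx (- e (idx (- e i))) = i" if "i < Suc n" for i
    using idx_eq[OF that] nu_cong[of 0 "e i"] cong_diff[OF cong_refl, of _ _ 0] by fastforce
  show "\<chi> (e i + e (idx (- e i))) = 0" for i
    using nu_cong[of "e i" "e i"] by (simp add: \<chi>_eq_0_iff cong_0_iff)
  show "\<chi> (e i + e j) \<in> {1, - 1}" if "i < Suc n" "j < Suc n" "j \<noteq> idx (- e i)" for i j
  proof (rule \<chi>_values)
    show "e i + e j \<notin> I"
    proof
      assume "e i + e j \<in> I"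
      then have "- e i \<approx> e j" using uminus_in[of "e i + e j"] by (simp add: cong_def)
      then show False using idx_eq that by metis
    qed
  qed
  show "(\<Sum>j<Suc n. \<chi> (e i + e j)) = 0" for i
    by (simp only: sum_shift[where F = \<chi>, OF \<chi>_cong] \<chi>_sum)
  show "\<chi> (e i' + e (idx (- e i))) = - \<chi> (e i + e (idx (- e i')))" for i i'
    using \<chi>_cong[OF nu_cong[of "e i" "e i'"]] \<chi>_cong[OF nu_cong[of "e i'" "e i"]]
      \<chi>_uminus[of "e i - e i'"] by simp
  show "(\<Sum>j<Suc n. \<chi> (e i + e j) * \<chi> (e i' + e j)) = (if i = i' then int (Suc n) else 0) - 1"
    if "i < Suc n" "i' < Suc n" for i i'
  proof -
    \<comment> \<open>Translating by \<open>e i\<close> leaves only the difference \<open>d\<close>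
      of the two row elements.\<close>
    define d where "d = e i' - e i"
    have "(\<Sum>j<Suc n. \<chi> (e i + e j) * \<chi> (e i' + e j)) =
        (\<Sum>j<Suc n. \<chi> (e i + e j) * \<chi> ((e i + e j) + d))"
      by (simp add: d_def algebra_simps)
    also have "\<dots> = (\<Sum>j<Suc n. \<chi> (e j) * \<chi> (e j + d))"
    proof (rule sum_shift)
      fix f g assume "f \<approx> g"
      then show "\<chi> f * \<chi> (f + d) = \<chi> g * \<chi> (g + d)"
        using \<chi>_cong[of f g] \<chi>_cong[OF cong_add[OF _ cong_refl], of f g d] by simp
    qed
    also have "\<dots> = (if i = i' then int (Suc n) else 0) - 1"
    proof (cases "i = i'")
      case True
      then have "(\<Sum>j<Suc n. \<chi> (e j) * \<chi> (e j + d)) = (\<Sum>j<Suc n. \<chi> (e j) * \<chi> (e j))"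
        by (simp add: d_def)
      then show ?thesis using True \<chi>_square_sum by simp
    next
      case False
      then have "d \<notin> I" using e_inj[of i' i] that by (auto simp: d_def cong_def)
      then show ?thesis using False \<chi>_correlation by simp
    qed
    finally show ?thesis .
  qed
qed

end

section \<open>Choice of the ideal and conclusion\<close>

text \<open>It remains to find an ideal for the locale: \<open>J\<close> consists of the polynomials
  whose value at \<open>\<zeta>\<close> is divisible by \<open>p\<close> in
  \<open>\<int>[\<zeta>]\<close>, and \<open>I\<close> is a maximal ideal above it. The residue of
  \<open>q\<close> modulo \<open>4\<close> gives \<open>n mod 4 = 2\<close>.\<close>

theorem symmetric_hadamard_primepow:
  fixes q :: nat
  assumes "primepow q" and "q mod 4 = 3"
  shows "\<exists>H. hadamard_mat (q * (1 + q)) H \<and> transpose_mat H = H"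
proof -
  from assms(1) obtain p k where p: "prime p" and q: "q = p ^ k"
    unfolding primepow_def by auto
  define n where "n = q - 1"
  obtain m where m: "q = 4 * m + 3" using assms(2) by (metis mult_div_mod_eq)
  then have "n = 4 * m + 2" by (simp add: n_def)
  then have n: "Suc n = q" "n mod 4 = 2" "n > 0" using m by (simp, presburger, simp)
  define \<zeta> where "\<zeta> = cis (2 * pi / real n)"
  let ?ev = "\<lambda>f :: int poly. poly (map_poly of_int f) \<zeta>"
  have \<zeta>: "\<zeta> ^ n = 1" using n by (simp add: \<zeta>_def DeMoivre)
  \<comment> \<open>\<open>J\<close> is proper because \<open>1 / p\<close> is not an algebraic integer.\<close>
  define J where "J = {f. \<exists>h. ?ev f = of_nat p * ?ev h}"
  have "ring_ideal J"
    unfolding ring_ideal_def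
  proof (intro conjI ballI allI)
    show "0 \<in> J" by (auto simp: J_def intro: exI[of _ 0])
    fix f assume "f \<in> J"
    then obtain h where h: "?ev f = of_nat p * ?ev h" by (auto simp: J_def)
    show "r * f \<in> J" for r
      using h by (auto simp: J_def of_int_poly_hom.hom_mult intro!: exI[of _ "r * h"])
    fix g assume "g \<in> J"
    then obtain h' where "?ev g = of_nat p * ?ev h'" by (auto simp: J_def)
    then show "f + g \<in> J"
      using h by (auto simp: J_def of_int_poly_hom.hom_add algebra_simps intro!: exI[of _ "h + h'"])
  qed
  moreover have "1 \<notin> J"
  proof
    assume "1 \<in> J"
    then obtain h where "1 = of_nat p * ?ev h" by (auto simp: J_def)
    then have h: "?ev h = 1 / of_nat p" using prime_gt_0_nat[OF p] by (simp add: nonzero_eq_divide_eq mult.commute)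
    have "algebraic_int (?ev h)"
      by (rule algebraic_int_poly_root_of_unity[OF n(3) \<zeta>])
    moreover have "?ev h \<in> \<rat>" by (simp add: h)
    ultimately have "?ev h \<in> \<int>" by (rule rational_algebraic_int_is_int)
    then obtain a where "?ev h = of_int a" by (elim Ints_cases)
    then have "of_int (int p * a) = (1 :: complex)"
      using h prime_gt_0_nat[OF p] by (simp add: field_simps)
    then have "int p * a = 1" by (simp only: of_int_eq_1_iff)
    then show False using prime_gt_1_nat[OF p] by (simp add: zmult_eq_1_iff)
  qed
  ultimately obtain I where I: "ring_ideal I" "J \<subseteq> I" "1 \<notin> I" "\<And>f. f \<notin> I \<Longrightarrow> \<exists>g. f * g - 1 \<in> I"
    using ex_maximal_ideal by metis
  \<comment> \<open>Both \<open>p\<close> and all polynomials vanishing at \<open>\<zeta>\<close>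
    lie in \<open>J\<close>, with cofactors \<open>1\<close> and \<open>0\<close>.\<close>
  have "?ev (of_nat p) = of_nat p * ?ev 1" unfolding of_nat_poly by (simp add: of_int_hom.map_poly_pCons_hom)
  then have "of_nat p \<in> J" unfolding J_def by blast
  moreover have "f \<in> J" if "?ev f = 0" for f using that by (auto simp: J_def intro!: exI[of _ 0])
  ultimately have pI: "of_nat p \<in> I" and kerI: "\<And>f. ?ev f = 0 \<Longrightarrow> f \<in> I" using I(2) by blast+
  interpret cyclotomic_residue_field p k n I
  proof
    show "Suc n = p ^ k" using n(1) q by simp
    show "f \<in> I" if "poly (map_poly of_int f) (cis (2 * pi / real n)) = 0" for f
      using kerI that unfolding \<zeta>_def .
    show "\<exists>g. f * g - 1 \<in> I" if "f \<notin> I" for f using that by (rule I(4))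
  qed (rule p n(2) I(1) I(3) pI)+
  show ?thesis using symmetric_hadamard by (simp only: n)
qed

theorem theorem2:
  fixes q :: nat
  assumes "primepow q" and "q mod 8 = 3"
  shows "\<exists>H. hadamard_mat (q * (1 + q)) H \<and> transpose_mat H = H"
proof -
  have "q mod 4 = 3" using mod_mod_cancel[of 4 8 q] assms(2) by simp
  with assms(1) show ?thesis by (rule symmetric_hadamard_primepow)
qed

end
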